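(* Let $q$ be a prime power. For all integers $h,s\ge 2$ we have $n_q(hs+\lfloor 0.5h\rfloor,h;s)\ge q^h+2$.
   Context: All dimensions are vector-space dimensions; a hyperplane of $\mathbb{F}_q^r$ is an $(r-1)$-dimensional subspace. A projective $h-(n,r,s)_q$ system is a multiset of $n$ subspaces of $\mathbb{F}_q^r$, each of dimension at most $h$, such that each hyperplane contains at most $s$ of these subspaces (counted with multiplicity) and some hyperplane contains exactly $s$ of them. $n_q(r,h;s)$ denotes the maximum $n$ such that a projective $h-(n,r,s)_q$ system exists. *)

theory Defs
  imports
    "Jordan_Normal_Form.VS_Connect"
    "HOL-Library.Multiset"
    "HOL-Number_Theory.Prime_Powers"
begin

abbreviation vec_subspace :: "'a::field itself \<Rightarrow> nat \<Rightarrow> 'a vec set \<Rightarrow> bool" where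
  "vec_subspace ty r W \<equiv> VectorSpace.subspace class_ring W (module_vec ty r)"

abbreviation vec_subspace_dim :: "'a::field itself \<Rightarrow> nat \<Rightarrow> 'a vec set \<Rightarrow> nat" where
  "vec_subspace_dim ty r W \<equiv> vectorspace.dim class_ring ((module_vec ty r)\<lparr>carrier := W\<rparr>)"

(* The condition is not written dim = r - 1 because of truncated subtraction at r = 0. *)
definition vec_hyperplane :: "'a::field itself \<Rightarrow> nat \<Rightarrow> 'a vec set \<Rightarrow> bool" where
  "vec_hyperplane ty r H \<longleftrightarrow> vec_subspace ty r H \<and> vec_subspace_dim ty r H + 1 = r"

definition projective_system ::
  "'a::{finite,field} itself \<Rightarrow> nat \<Rightarrow> nat \<Rightarrow> nat \<Rightarrow> nat \<Rightarrow> 'a vec set multiset \<Rightarrow> bool" where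
  "projective_system ty h n r s S \<longleftrightarrow>
     size S = n \<and>
     (\<forall>W \<in># S. vec_subspace ty r W \<and> vec_subspace_dim ty r W \<le> h) \<and>
     (\<forall>H. vec_hyperplane ty r H \<longrightarrow> size {#W \<in># S. W \<subseteq> H#} \<le> s) \<and>
     (\<exists>H. vec_hyperplane ty r H \<and> size {#W \<in># S. W \<subseteq> H#} = s)"

(* The type argument is the field with q elements. For h < r the set below is finite, since every
   member of a system then lies in one of the finitely many hyperplanes. If h \<ge> r it can be
   infinite, and Max is then unspecified. *)
definition max_projective_system :: "'a::{finite,field} itself \<Rightarrow> nat \<Rightarrow> nat \<Rightarrow> nat \<Rightarrow> nat" where
  "max_projective_system ty r h s = Max {n. \<exists>S. projective_system ty h n r s S}"

end

(* Let L be the field with q^h elements, m = h div 2 and r = h s + m. A vector c over F_q of length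
   r encodes the polynomial f_c = a_0 + a_1 x + ... + a_s x^s over L, where a_j has the j-th block of
   h entries of c as coordinates and a_s ranges over an m-dimensional subspace only. For x in L, the
   map c -> f_c(x) is given by h linear functionals, that is, by a subspace of dimension at most h
   which lies in the hyperplane orthogonal to c only if f_c(x) = 0. So each hyperplane contains at
   most deg f_c of these q^h subspaces.
   As a_s needs only m coordinates, two further subspaces fit: each is spanned by unit vectors that
   read off a_s together with h - m coordinates of a_(s-1), chosen so that both of them vanish on c
   only if a_s = a_(s-1) = 0. If one of them lies in the hyperplane then deg f_c <= s - 1, and if
   both do then deg f_c <= s - 2; the total count is at most s in every case. *)
theory Submission
  imports Defs "HOL-Algebra.Algebraic_Closure_Type" "HOL-Number_Theory.Residues"
begin

section \<open>The field of order q^h in the algebraic closure\<close>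

lemma card_UNIV_eq_CHAR_power:
  assumes "primepow (card (UNIV :: 'a::{finite,field} set))"
  obtains k where "k > 0" "card (UNIV :: 'a set) = CHAR('a) ^ k" "Factorial_Ring.prime CHAR('a)"
proof -
  have prime: "Factorial_Ring.prime CHAR('a)"
    by (intro prime_CHAR_semidom finite_imp_CHAR_pos) simp
  obtain p k where pk: "Factorial_Ring.prime p" "k > 0" "card (UNIV :: 'a set) = p ^ k"
    using assms by (auto simp: primepow_def)
  have "CHAR('a) dvd p ^ k"
    using CHAR_dvd_CARD[where 'a = 'a] pk by simp
  then have "CHAR('a) = p"
    using prime pk(1) prime_dvd_power primes_dvd_imp_eq by blast
  then show thesis using that pk by simp
qed

text \<open>Multiplication by a nonzero \<open>y\<close> permutes the nonzero elements, so their
  product absorbs the factor \<open>y ^ (q - 1)\<close>, where q is the order of the field. This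
  makes scalars fixed points below.\<close>

lemma power_card_UNIV_power:
  fixes x :: "'a::{finite,field}"
  shows "x ^ (card (UNIV :: 'a set) ^ h) = x"
proof -
  have base: "y ^ card (UNIV :: 'a set) = y" for y :: 'a
  proof (cases "y = 0")
    case False
    let ?P = "\<Prod>(UNIV - {0} :: 'a set)"
    have "?P = (\<Prod>z\<in>UNIV - {0}. y * z)"
      by (rule prod.reindex_bij_witness[of _ "\<lambda>z. y * z" "\<lambda>z. z / y"]) (use False in auto)
    also have "\<dots> = y ^ (card (UNIV :: 'a set) - 1) * ?P"
      by (simp add: prod.distrib card_Diff_singleton)
    finally have "y ^ (card (UNIV :: 'a set) - 1) = 1"
      by simp
    then show ?thesis
      using finite_UNIV_card_ge_0[where 'a = 'a] by (metis One_nat_def Suc_pred finite mult.right_neutral power_Suc)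
  qed (use finite_UNIV_card_ge_0[where 'a = 'a] in auto)
  show ?thesis
    by (induction h arbitrary: x) (simp_all add: power_mult base)
qed

text \<open>The fixed points of the h-fold iterate of the Frobenius map x -> x^q. For h > 0 this is
  the copy of the field of order q^h inside the algebraic closure.\<close>

definition extension_field :: "nat \<Rightarrow> 'a::{finite,field} alg_closure set" where
  "extension_field h = {x. x ^ (card (UNIV :: 'a set) ^ h) = x}"

context
  fixes h :: nat
  assumes primepow: "primepow (card (UNIV :: 'a::{finite,field} set))" and h: "h > 0"
begin

lemma extension_field_add:
  "x \<in> extension_field h \<Longrightarrow> y \<in> extension_field h \<Longrightarrow> (x + y :: 'a alg_closure) \<in> extension_field h"
proof -
  obtain k where "k > 0" "card (UNIV :: 'a set) = CHAR('a) ^ k" "Factorial_Ring.prime CHAR('a)"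
    using card_UNIV_eq_CHAR_power[OF primepow] by blast
  then have "(x + y) ^ (card (UNIV :: 'a set) ^ h) =
      x ^ (card (UNIV :: 'a set) ^ h) + y ^ (card (UNIV :: 'a set) ^ h)"
    by (intro freshmans_dream'[where n = "k * h"]) (simp_all only: CHAR_alg_closure power_mult)
  then show "x \<in> extension_field h \<Longrightarrow> y \<in> extension_field h \<Longrightarrow> x + y \<in> extension_field h"
    by (simp add: extension_field_def)
qed

lemma zero_in_extension_field: "(0 :: 'a alg_closure) \<in> extension_field h"
  using finite_UNIV_card_ge_0[where 'a = 'a] by (simp add: extension_field_def)

text \<open>With N = q^h, the polynomial X^N - X splits over the closure, and its derivative -1 has
  no zero, so its N roots are distinct.\<close>

lemma card_extension_field:
  "card (extension_field h :: 'a alg_closure set) = card (UNIV :: 'a set) ^ h"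
proof -
  define N where "N = card (UNIV :: 'a set) ^ h"
  obtain k where k: "k > 0" "card (UNIV :: 'a set) = CHAR('a) ^ k" "Factorial_Ring.prime CHAR('a)"
    using card_UNIV_eq_CHAR_power[OF primepow] by blast
  have "card (UNIV :: 'a set) > 1"
    using k by (metis one_less_power prime_gt_1_nat)
  then have N: "N > 1"
    unfolding N_def using h by (intro one_less_power)
  have "CHAR('a) dvd N"
    unfolding N_def k(2) using k(1) h by (simp add: dvd_power flip: power_mult)
  \<comment> \<open>This removes the term N X^(N-1) from the derivative of \<open>P\<close>.\<close>
  then have N0: "of_nat N = (0 :: 'a alg_closure)"
    by (simp add: of_nat_eq_0_iff_char_dvd)
  define P where "P = Polynomial.monom 1 N - [:0, 1 :: 'a alg_closure:]"
  have poly_P: "poly P x = x ^ N - x" for x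
    by (simp add: P_def poly_monom)
  have deg: "Polynomial.degree P = N"
    unfolding P_def diff_conv_add_uminus using N
    by (subst degree_add_eq_left) (simp_all add: Polynomial.degree_monom_eq)
  have P0: "P \<noteq> 0" using deg N by auto
  obtain A where A: "size A = Polynomial.degree P"
      "P = Polynomial.smult (Polynomial.lead_coeff P) (\<Prod>x\<in>#A. [:-x, 1:])"
    using alg_closed_imp_factorization[OF P0] by blast
  have poly_A: "poly P x = Polynomial.lead_coeff P * (\<Prod>y\<in>#A. x - y)" for x
    by (subst A(2)) (simp add: poly_prod_mset)
  have set_A: "set_mset A = extension_field h"
  proof -
    have "x \<in># A \<longleftrightarrow> poly P x = 0" for x
      using P0 by (auto simp: poly_A)
    then show ?thesis by (auto simp: poly_P extension_field_def N_def)
  qed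
  have count_A: "count A a \<le> 1" for a
  proof (rule ccontr)
    assume "\<not> count A a \<le> 1"
    then have "{#a, a#} \<subseteq># A"
      by (auto simp: subseteq_mset_def)
    then obtain B where B: "A = {#a, a#} + B"
      by (metis subset_mset.add_diff_inverse)
    define Q where "Q = Polynomial.smult (Polynomial.lead_coeff P) (\<Prod>x\<in>#B. [:-x, 1:])"
    \<comment> \<open>A repeated root \<open>a\<close> gives a factor (X - a)^2, and each summand of
      the product rule then keeps a factor X - a.\<close>
    have "P = [:-a, 1:] * ([:-a, 1:] * Q)"
      by (subst A(2)) (simp add: B Q_def)
    moreover have "poly (pderiv ([:-a, 1:] * ([:-a, 1:] * Q))) a = 0"
      by (simp only: pderiv_mult poly_add poly_mult) simp
    ultimately have "poly (pderiv P) a = 0"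
      by simp
    moreover have "pderiv P = -1"
      by (simp add: P_def pderiv_diff pderiv_monom N0 pderiv_pCons one_pCons)
    ultimately show False by simp
  qed
  have "count A x = count (mset_set (set_mset A)) x" for x
  proof (cases "x \<in># A")
    case True
    then have "count A x > 0" by (simp only: count_greater_zero_iff)
    then show ?thesis using count_A[of x] True by (simp del: count_greater_zero_iff)
  qed (simp add: count_eq_zero_iff)
  then have "A = mset_set (set_mset A)"
    by (rule multiset_eqI)
  then have "size A = card (set_mset A)"
    by (metis size_mset_set)
  then show ?thesis
    using A(1) deg set_A N_def by simp
qed

text \<open>The size of a basis is found by counting: if \<open>B\<close> is a basis over F_q, then
  coordinate families on \<open>B\<close> biject with the field, so q^|B| = q^h.\<close>

lemma extension_field_basis:
  obtains e :: "nat \<Rightarrow> 'a alg_closure" and co :: "'a alg_closure \<Rightarrow> nat \<Rightarrow> 'a" where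
    "\<forall>i<h. e i \<in> extension_field h"
    "\<forall>x\<in>extension_field h. x = (\<Sum>i<h. to_ac (co x i) * e i)"
    "\<forall>c. (\<Sum>i<h. to_ac (c i) * e i) = 0 \<longrightarrow> (\<forall>i<h. c i = 0)"
proof -
  let ?L = "extension_field h :: 'a alg_closure set"
  interpret V: vector_space "\<lambda>c (x :: 'a alg_closure). to_ac c * x"
    by standard (simp_all add: algebra_simps)
  have sub: "V.subspace ?L"
  proof (rule V.subspaceI)
    show "to_ac c * x \<in> ?L" if "x \<in> ?L" for c x
      using that by (simp add: extension_field_def power_mult_distrib power_card_UNIV_power flip: to_ac_power)
  qed (use zero_in_extension_field extension_field_add in auto)
  obtain B where B: "B \<subseteq> ?L" "V.independent B" "?L \<subseteq> V.span B"
    using V.basis_exists by metis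
  have span: "V.span B = ?L"
    using B(1,3) sub V.span_minimal by blast
  have q: "card (UNIV :: 'a set) > 1"
    using primepow primepow_gt_Suc_0 by fastforce
  have finL: "finite ?L"
    using card_extension_field q h by (intro card_ge_0_finite) simp
  then have finB: "finite B" using B(1) finite_subset by blast
  define \<phi> where "\<phi> = (\<lambda>c. \<Sum>b\<in>B. to_ac (c b) * b)"
  \<comment> \<open>Extensional functions are used so that a coordinate family is determined by its
    values on \<open>B\<close>.\<close>
  have "inj_on \<phi> (B \<rightarrow>\<^sub>E (UNIV :: 'a set))"
  proof (rule inj_onI)
    fix c d assume cd: "c \<in> B \<rightarrow>\<^sub>E (UNIV :: 'a set)" "d \<in> B \<rightarrow>\<^sub>E UNIV" "\<phi> c = \<phi> d"
    have "(\<Sum>b\<in>B. to_ac (c b - d b) * b) = 0"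
      using cd(3) by (simp add: \<phi>_def algebra_simps sum_subtractf)
    then have "c b = d b" if "b \<in> B" for b
      using V.independentD[OF B(2) finB order_refl, of "\<lambda>b. c b - d b"] that by auto
    then show "c = d" using cd(1,2) by (metis PiE_ext)
  qed
  moreover have "\<phi> ` (B \<rightarrow>\<^sub>E (UNIV :: 'a set)) = ?L"
  proof -
    have "?L = range (\<lambda>c. \<Sum>b\<in>B. to_ac (c b) * b)"
      using span V.span_finite[OF finB] by simp
    also have "\<dots> = \<phi> ` (B \<rightarrow>\<^sub>E (UNIV :: 'a set))"
    proof -
      have "\<phi> c = \<phi> (restrict c B)" for c by (simp add: \<phi>_def)
      then have "range \<phi> \<subseteq> \<phi> ` (B \<rightarrow>\<^sub>E UNIV)"
        by (metis (no_types, lifting) UNIV_I image_eqI image_subsetI restrict_PiE_iff)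
      then show ?thesis unfolding \<phi>_def[symmetric] by auto
    qed
    finally show ?thesis by simp
  qed
  ultimately have "card ?L = card (B \<rightarrow>\<^sub>E (UNIV :: 'a set))"
    by (metis card_image)
  then have "card (UNIV :: 'a set) ^ h = card (UNIV :: 'a set) ^ card B"
    using finB by (simp add: card_extension_field card_funcsetE)
  then have "card B = h" using q by simp
  then obtain e where e: "bij_betw e {..<h} B"
    using finB ex_bij_betw_nat_finite lessThan_atLeast0 by metis
  have sum_e: "(\<Sum>i<h. to_ac (c i) * e i) = (\<Sum>b\<in>B. to_ac (c (the_inv_into {..<h} e b)) * b)" for c
    by (rule sum.reindex_bij_betw[OF e, symmetric, THEN trans[OF _ sum.cong], symmetric])
      (use e in \<open>auto simp: the_inv_into_f_f bij_betw_def\<close>)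
  have "\<exists>c. x = (\<Sum>i<h. to_ac (c i) * e i)" if "x \<in> ?L" for x
  proof -
    have "x \<in> V.span B" using that span by simp
    then obtain c where "x = (\<Sum>b\<in>B. to_ac (c b) * b)"
      unfolding V.span_finite[OF finB] by blast
    also have "\<dots> = (\<Sum>i<h. to_ac (c (e i)) * e i)"
      by (rule sum.reindex_bij_betw[OF e, symmetric])
    finally show ?thesis by (rule exI[of _ "\<lambda>i. c (e i)"])
  qed
  then have "\<exists>co. \<forall>x\<in>?L. x = (\<Sum>i<h. to_ac (co x i) * e i)"
    by (intro bchoice ballI)
  then obtain co where co: "\<forall>x\<in>?L. x = (\<Sum>i<h. to_ac (co x i) * e i)" ..
  have indep: "c i = 0" if "(\<Sum>i<h. to_ac (c i) * e i) = 0" "i < h" for c i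
  proof -
    have "c (the_inv_into {..<h} e (e i)) = 0"
      using V.independentD[OF B(2) finB order_refl] that e unfolding sum_e
      by (metis bij_betwE lessThan_iff)
    then show ?thesis using that(2) e by (simp add: the_inv_into_f_f bij_betw_def)
  qed
  show thesis
  proof (rule that)
    show "\<forall>i<h. e i \<in> ?L"
      using e B(1) by (auto simp: bij_betw_def)
  qed (fact co, use indep in blast)
qed

end

section \<open>Subspaces and hyperplanes of the coordinate space\<close>

lemma finite_carrier_vec: "finite (carrier_vec r :: 'a::finite vec set)"
proof -
  have "inj_on list_of_vec (carrier_vec r :: 'a vec set)"
    by (intro inj_onI) (metis vec_list)
  moreover have "list_of_vec ` carrier_vec r \<subseteq> {xs :: 'a list. set xs \<subseteq> UNIV \<and> length xs = r}"
    by auto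
  ultimately show ?thesis
    using finite_lists_length_eq[of "UNIV :: 'a set" r] finite_imageD finite_subset by fastforce
qed

context
  fixes ty :: "'a::{finite,field} itself" and r :: nat
begin

interpretation vec_space "TYPE('a::{finite,field})" r .

lemma vec_subspace_subset: "vec_subspace TYPE('a::{finite,field}) r W \<Longrightarrow> W \<subseteq> carrier_vec r"
  using submodule.subset[of class_ring W V] is_module by simp

text \<open>Dimension refers to \<open>W\<close> as a space of its own; span and independence agree
  there and in the ambient space, so a basis can be moved across. Finiteness of \<open>W\<close>
  makes \<open>W\<close> itself a finite generating set.\<close>

lemma vec_subspace_basis:
  assumes "vec_subspace TYPE('a) r W"
  obtains b where "finite b" "b \<subseteq> carrier_vec r" "lin_indpt b" "span b = W"
    "card b = vec_subspace_dim TYPE('a) r W"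
proof -
  have sub: "submodule class_ring W V" using assms by simp
  have vsW: "vectorspace class_ring (vs W)"
    by (rule subspace_is_vs) (rule assms)
  have finW: "finite W"
    using vec_subspace_subset[OF assms] finite_carrier_vec finite_subset by blast
  have "W \<subseteq> span W" using in_own_span vec_subspace_subset[OF assms] by simp
  moreover have "span W \<subseteq> W" by (rule span_is_subset[OF order_refl sub])
  ultimately have "LinearCombinations.module.span class_ring (vs W) W = W"
    using span_li_not_depend(1)[OF order_refl sub] by simp
  then have "vectorspace.fin_dim class_ring (vs W)"
    unfolding vectorspace.fin_dim_def[OF vsW] using finW by (intro exI[of _ W]) simp
  then obtain b where b: "finite b" "vectorspace.basis class_ring (vs W) b"
    using vectorspace.finite_basis_exists[OF vsW] by blast
  have bW: "b \<subseteq> W" using b(2) vectorspace.basis_def[OF vsW] by simp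
  have "span b = W" "lin_indpt b"
    using b(2) span_li_not_depend[OF bW sub] unfolding vectorspace.basis_def[OF vsW] by simp_all
  then show thesis
    using that[of b] b bW vec_subspace_subset[OF assms] vectorspace.dim_basis[OF vsW b] by simp
qed

lemma vec_subspace_span: "A \<subseteq> carrier_vec r \<Longrightarrow> vec_subspace TYPE('a) r (span A)"
  using span_is_subspace by simp

lemma vec_subspace_dim_span_le:
  assumes "finite A" "A \<subseteq> carrier_vec r"
  shows "vec_subspace_dim TYPE('a) r (span A) \<le> card A"
proof -
  have sub: "submodule class_ring (span A) V" using assms by (intro span_is_submodule) simp
  have vsW: "vectorspace class_ring (vs (span A))"
    by (rule subspace_is_vs) (rule vec_subspace_span[OF assms(2)])
  have A: "A \<subseteq> span A" using in_own_span assms by simp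
  show ?thesis
    using vectorspace.gen_ge_dim[OF vsW assms(1)] A span_li_not_depend(1)[OF A sub] by simp
qed

lemma vec_subspace_containing:
  assumes "A \<subseteq> carrier_vec r" "finite A" "card A \<le> h"
  shows "\<exists>W. vec_subspace TYPE('a) r W \<and> vec_subspace_dim TYPE('a) r W \<le> h \<and> A \<subseteq> W"
  using vec_subspace_span[OF assms(1)] vec_subspace_dim_span_le[OF assms(2,1)] assms in_own_span[of A]
  by (intro exI[of _ "span A"]) auto

section \<open>Orthogonal vectors and hyperplanes containing a given subspace\<close>

text \<open>A basis of \<open>W\<close>, written as the rows of a square matrix and padded by zero
  rows, gives a singular matrix; any nonzero kernel vector is orthogonal to
  \<open>W\<close>.\<close>

lemma vec_subspace_in_kernel:
  assumes "vec_subspace TYPE('a) r W" "vec_subspace_dim TYPE('a) r W < r"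
  obtains c where "c \<in> carrier_vec r" "c \<noteq> 0\<^sub>v r" "\<And>v. v \<in> W \<Longrightarrow> v \<bullet> c = 0"
proof -
  obtain b where b: "finite b" "b \<subseteq> carrier_vec r" "span b = W" "card b = vec_subspace_dim TYPE('a) r W"
    using vec_subspace_basis[OF assms(1)] by metis
  obtain f where f: "bij_betw f {0..<card b} b"
    using b(1) ex_bij_betw_nat_finite by blast
  define g where "g = (\<lambda>i. if i < card b then f i else 0\<^sub>v r)"
  have g: "g i \<in> carrier_vec r" for i
    using f b(2) by (auto simp: g_def bij_betw_def)
  define M where "M = mat\<^sub>r r r g"
  \<comment> \<open>Row \<open>card b\<close> is the first padding row; it exists because the
    dimension is less than r.\<close>
  have "g = (\<lambda>i. if i = card b then 0\<^sub>v r else g i)"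
    by (auto simp: g_def)
  then have "det M = 0"
    unfolding M_def using det_row_0[of "card b" r g] assms(2) b(4) g by auto
  then obtain c where c: "c \<in> carrier_vec r" "c \<noteq> 0\<^sub>v r" "M *\<^sub>v c = 0\<^sub>v r"
    using det_0_iff_vec_prod_zero_field[of M r] by (auto simp: M_def)
  have bc: "v \<bullet> c = 0" if v: "v \<in> b" for v
  proof -
    obtain i where i: "i < card b" "v = f i"
      using v f by (metis bij_betw_def atLeastLessThan_iff imageE)
    have "(M *\<^sub>v c) $ i = g i \<bullet> c"
      using i(1) assms(2) b(4) g by (simp add: M_def carrier_vecD)
    then show ?thesis using c(3) i assms(2) b(4) by (simp add: g_def)
  qed
  have "v \<bullet> c = 0" if "v \<in> span b" for v
  proof -
    obtain a A where A: "finite A" "A \<subseteq> b" "v = lincomb a A"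
      using \<open>v \<in> span b\<close> unfolding span_def by auto
    have "v \<bullet> c = (\<Sum>u\<in>A. (a u \<cdot>\<^sub>v u) \<bullet> c)"
      unfolding A(3) lincomb_def using A b(2) c(1) by (intro finsum_scalar_prod_sum) auto
    also have "\<dots> = 0"
      using A b(2) c(1) bc by (intro sum.neutral) (auto simp: subset_iff)
    finally show ?thesis .
  qed
  then show thesis using that[OF c(1,2)] b(3) by blast
qed

text \<open>A maximal proper subspace above \<open>W\<close> is a hyperplane: adjoining one more
  vector to it already generates the whole space.\<close>

lemma vec_subspace_subset_hyperplane:
  assumes "vec_subspace TYPE('a) r W" "vec_subspace_dim TYPE('a) r W < r"
  obtains H where "vec_hyperplane TYPE('a) r H" "W \<subseteq> H"
proof -
  define P where "P = {M. vec_subspace TYPE('a) r M \<and> W \<subseteq> M \<and> M \<noteq> carrier_vec r}"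
  have "finite P"
    by (rule finite_subset[of _ "Pow (carrier_vec r)"])
      (auto simp: P_def finite_carrier_vec dest: vec_subspace_subset)
  moreover have "W \<in> P"
  proof -
    obtain b where b: "finite b" "b \<subseteq> carrier_vec r" "span b = W" "card b = vec_subspace_dim TYPE('a) r W"
      using vec_subspace_basis[OF assms(1)] by metis
    have "W \<noteq> carrier_vec r"
      using gen_ge_dim[of b] b assms(2) dim_is_n by auto
    then show ?thesis using assms(1) by (simp add: P_def)
  qed
  ultimately have "\<exists>M\<in>P. W \<subseteq> M \<and> (\<forall>M'\<in>P. M \<subseteq> M' \<longrightarrow> M = M')"
    by (rule finite_has_maximal2)
  then obtain M where M: "M \<in> P" "\<And>M'. M' \<in> P \<Longrightarrow> M \<subseteq> M' \<Longrightarrow> M' = M"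
    by metis
  have subM: "vec_subspace TYPE('a) r M" and neM: "M \<noteq> carrier_vec r" and WM: "W \<subseteq> M"
    using M(1) by (auto simp: P_def)
  obtain b where b: "finite b" "b \<subseteq> carrier_vec r" "lin_indpt b" "span b = M"
      "card b = vec_subspace_dim TYPE('a) r M"
    using vec_subspace_basis[OF subM] by metis
  obtain v where v: "v \<in> carrier_vec r" "v \<notin> M"
    using neM vec_subspace_subset[OF subM] by blast
  have ins: "insert v b \<subseteq> carrier_vec r" using v b by simp
  have "M \<subseteq> span (insert v b)"
    using b(4) span_is_monotone[of b "insert v b"] by auto
  moreover have "v \<in> span (insert v b)"
    using in_own_span[of "insert v b"] ins by auto
  ultimately have "span (insert v b) \<notin> P"
    using M(2) v(2) by blast
  then have "span (insert v b) = carrier_vec r"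
    using vec_subspace_span[OF ins] \<open>M \<subseteq> span (insert v b)\<close> WM by (auto simp: P_def)
  then have "r \<le> card (insert v b)"
    using gen_ge_dim[of "insert v b"] ins b(1) dim_is_n by simp
  then have "r \<le> card b + 1"
    using b(1) card_insert_le_m1 by (metis Suc_eq_plus1 card_insert_if le_SucI)
  \<comment> \<open>Otherwise the independent set \<open>b\<close> would be a basis of the whole
    space, although \<open>M\<close> is proper.\<close>
  moreover have "card b < r"
  proof (rule ccontr)
    assume "\<not> card b < r"
    then have "basis b"
      using b by (intro dim_li_is_basis) (auto simp: dim_is_n)
    then show False using b(4) neM by (simp add: basis_def)
  qed
  ultimately have "vec_subspace_dim TYPE('a) r M + 1 = r" using b(5) by simp
  then show thesis using that[of M] subM WM by (simp add: vec_hyperplane_def)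
qed

end

section \<open>Lower bounds for projective systems\<close>

lemma finite_vec_hyperplanes: "finite {H. vec_hyperplane TYPE('a::{finite,field}) r H}"
  by (rule finite_subset[of _ "Pow (carrier_vec r)"])
    (auto simp: finite_carrier_vec vec_hyperplane_def dest: vec_subspace_subset)

text \<open>Incident pairs of a member and a hyperplane are counted: each member occurs at least
  once, each hyperplane at most s times. The crude bound serves to make the set under
  \<open>Max\<close> finite.\<close>

lemma size_projective_system_le:
  assumes "projective_system TYPE('a::{finite,field}) h n r s S" "h < r"
  shows "n \<le> s * card {H. vec_hyperplane TYPE('a) r H}"
proof -
  let ?HH = "{H. vec_hyperplane TYPE('a) r H}"
  have cover: "\<exists>H\<in>?HH. W \<subseteq> H" if "W \<in># S" for W
  proof -
    have "vec_subspace TYPE('a) r W" "vec_subspace_dim TYPE('a) r W < r"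
      using assms that by (auto simp: projective_system_def)
    then show ?thesis using vec_subspace_subset_hyperplane[of W r] by auto
  qed
  have "size S \<le> (\<Sum>H\<in>?HH. size {#W \<in># S. W \<subseteq> H#})"
    using cover
  proof (induction S)
    case (add W S)
    obtain H0 where H0: "H0 \<in> ?HH" "W \<subseteq> H0"
      using add.prems by auto
    have "size (add_mset W S) \<le> (\<Sum>H\<in>?HH. size {#W \<in># S. W \<subseteq> H#}) + 1"
      using add by simp
    \<comment> \<open>The hyperplane \<open>H0\<close> alone makes the sum of indicators at least
      1.\<close>
    also have "\<dots> \<le> (\<Sum>H\<in>?HH. size {#W \<in># S. W \<subseteq> H#}) + (\<Sum>H\<in>?HH. if W \<subseteq> H then 1 else 0)"
      using H0 member_le_sum[of H0 ?HH "\<lambda>H. if W \<subseteq> H then 1 else (0::nat)"] finite_vec_hyperplanes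
      by auto
    also have "\<dots> = (\<Sum>H\<in>?HH. size {#W' \<in># add_mset W S. W' \<subseteq> H#})"
      by (subst sum.distrib[symmetric]) (rule sum.cong, auto)
    finally show ?case .
  qed simp
  also have "\<dots> \<le> (\<Sum>H\<in>?HH. s)"
    using assms(1) by (intro sum_mono) (simp add: projective_system_def)
  finally show ?thesis
    using assms(1) by (simp add: projective_system_def mult.commute)
qed

lemma max_projective_system_ge:
  assumes "projective_system TYPE('a::{finite,field}) h n r s S" "h < r"
  shows "n \<le> max_projective_system TYPE('a) r h s"
proof -
  have "finite {n. \<exists>S. projective_system TYPE('a) h n r s S}"
  proof (rule finite_subset)
    show "{n. \<exists>S. projective_system TYPE('a) h n r s S} \<subseteq> {..s * card {H. vec_hyperplane TYPE('a) r H}}"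
      using size_projective_system_le[OF _ assms(2)] by blast
  qed simp
  then show ?thesis
    unfolding max_projective_system_def using assms(1) by (intro Max_ge) auto
qed

section \<open>Padding and exchange with the zero space\<close>

lemma vec_subspace_zero:
  obtains Z where "vec_subspace TYPE('a::{finite,field}) r Z" "vec_subspace_dim TYPE('a) r Z = 0"
    "\<And>H. vec_hyperplane TYPE('a) r H \<Longrightarrow> Z \<subseteq> H"
proof -
  interpret vec_space "TYPE('a)" r .
  have "span {} \<subseteq> H" if "vec_hyperplane TYPE('a) r H" for H
    using that by (intro span_is_subset) (simp_all add: vec_hyperplane_def)
  then show thesis
    using that[of "span {}"] vec_subspace_span[of "{}" r] vec_subspace_dim_span_le[of "{}" r] by simp
qed

(* Replacing members by the zero space one at a time raises each hyperplane count by at most one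
   per step, so the value s is attained along the way. *)
lemma projective_system_attaining:
  fixes S :: "'a::{finite,field} vec set multiset"
  assumes mem: "\<forall>W \<in># S. vec_subspace TYPE('a) r W \<and> vec_subspace_dim TYPE('a) r W \<le> h"
    and le: "\<forall>H. vec_hyperplane TYPE('a) r H \<longrightarrow> size {#W \<in># S. W \<subseteq> H#} \<le> s"
    and s: "s \<le> size S" and r: "r > 0"
  obtains S' where "projective_system TYPE('a) h (size S) r s S'"
proof -
  obtain Z where Z: "vec_subspace TYPE('a) r Z" "vec_subspace_dim TYPE('a) r Z = 0"
      "\<And>H. vec_hyperplane TYPE('a) r H \<Longrightarrow> Z \<subseteq> H"
    using vec_subspace_zero by metis
  obtain H0 where H0: "vec_hyperplane TYPE('a) r H0"
    using vec_subspace_subset_hyperplane[of Z r] Z r by metis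
  define P where "P = (\<lambda>T. size T = size S \<and>
    (\<forall>W \<in># T. vec_subspace TYPE('a) r W \<and> vec_subspace_dim TYPE('a) r W \<le> h) \<and>
    (\<forall>H. vec_hyperplane TYPE('a) r H \<longrightarrow> size {#W \<in># T. W \<subseteq> H#} \<le> s))"
  have "P S" using mem le by (simp add: P_def)
  moreover have "count T Z < Suc (size S)" if "P T" for T
    using that count_le_size[of T Z] by (simp add: P_def)
  \<comment> \<open>The repeated exchange is expressed by an extremal choice: among all admissible
    multisets of this size, one with the most copies of \<open>Z\<close>.\<close>
  ultimately obtain T where T: "P T" "\<And>T'. P T' \<Longrightarrow> count T' Z \<le> count T Z"
    using ex_has_greatest_nat[of P S "\<lambda>T. count T Z" "Suc (size S)"] by blast
  have "\<exists>H. vec_hyperplane TYPE('a) r H \<and> size {#W \<in># T. W \<subseteq> H#} = s"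
  proof (rule ccontr)
    assume "\<not> ?thesis"
    then have less: "size {#W \<in># T. W \<subseteq> H#} < s" if "vec_hyperplane TYPE('a) r H" for H
      using that T(1) unfolding P_def by (metis le_neq_implies_less)
    \<comment> \<open>\<open>T\<close> has at least s members, of which fewer than s lie in
      \<open>H0\<close>, so some member is left to exchange for \<open>Z\<close>.\<close>
    have "{#W \<in># T. W \<subseteq> H0#} \<noteq> T"
      using less[OF H0] T(1) s by (auto simp: P_def)
    then obtain W where W: "W \<in># T" "\<not> W \<subseteq> H0"
      by (metis filter_mset_True filter_mset_cong)
    define T' where "T' = add_mset Z (T - {#W#})"
    have "size {#W' \<in># T'. W' \<subseteq> H#} \<le> s" if H: "vec_hyperplane TYPE('a) r H" for H
    proof -
      have "size {#W' \<in># T'. W' \<subseteq> H#} \<le> Suc (size {#W' \<in># T - {#W#}. W' \<subseteq> H#})"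
        by (simp add: T'_def)
      also have "\<dots> \<le> Suc (size {#W' \<in># T. W' \<subseteq> H#})"
        by (intro Suc_leI le_imp_less_Suc size_mset_mono multiset_filter_mono diff_subset_eq_self)
      finally show ?thesis using less[OF H] by simp
    qed
    moreover have "size T' = size S"
      using T(1) W(1) by (simp add: P_def T'_def size_Suc_Diff1)
    ultimately have "P T'"
      using T(1) Z unfolding P_def T'_def by (auto dest: in_diffD)
    moreover have "W \<noteq> Z" using W(2) Z(3)[OF H0] by blast
    then have "count T' Z = Suc (count T Z)"
      by (simp add: T'_def)
    ultimately show False using T(2) by fastforce
  qed
  then show thesis using that[of T] T(1) by (simp add: projective_system_def P_def)
qed

text \<open>Reduces a lower bound to the upper estimate on hyperplane counts; that some hyperplane
  attains s is arranged by padding and exchange.\<close>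

lemma max_projective_system_ge_size:
  fixes S :: "'a::{finite,field} vec set multiset"
  assumes mem: "\<And>W. W \<in># S \<Longrightarrow> vec_subspace TYPE('a) r W \<and> vec_subspace_dim TYPE('a) r W \<le> h"
    and le: "\<And>H. vec_hyperplane TYPE('a) r H \<Longrightarrow> size {#W \<in># S. W \<subseteq> H#} \<le> s"
    and hr: "h < r"
  shows "size S \<le> max_projective_system TYPE('a) r h s"
proof -
  obtain Z where Z: "vec_subspace TYPE('a) r Z" "vec_subspace_dim TYPE('a) r Z = 0"
    using vec_subspace_zero by metis
  \<comment> \<open>The truncated difference pads up to exactly s members, and adds nothing if there
    are already that many.\<close>
  define S' where "S' = S + replicate_mset (s - size S) Z"
  have mem': "\<forall>W \<in># S'. vec_subspace TYPE('a) r W \<and> vec_subspace_dim TYPE('a) r W \<le> h"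
    using mem Z by (auto simp: S'_def)
  have le': "size {#W \<in># S'. W \<subseteq> H#} \<le> s" if "vec_hyperplane TYPE('a) r H" for H
  proof (cases "size S < s")
    case True
    have "size {#W \<in># S'. W \<subseteq> H#} \<le> size S'" by (rule size_mset_mono) simp
    then show ?thesis using True by (simp add: S'_def)
  qed (use le[OF that] in \<open>simp add: S'_def\<close>)
  have "s \<le> size S'" by (simp add: S'_def)
  then obtain T where "projective_system TYPE('a) h (size S') r s T"
    using projective_system_attaining[of S' r h s] mem' le' hr by (metis gr_zeroI not_less_zero)
  then have "size S' \<le> max_projective_system TYPE('a) r h s"
    using hr by (rule max_projective_system_ge)
  then show ?thesis by (simp add: S'_def)
qed

section \<open>Shortened Reed--Solomon codes with two additional positions\<close>

(* L is a field of order q^h inside the algebraic closure, with basis e and coordinate map co.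
   It is only described by closure properties, since a type cannot depend on h. *)
locale extension_code =
  fixes e :: "nat \<Rightarrow> 'a::{finite,field} alg_closure" and co :: "'a alg_closure \<Rightarrow> nat \<Rightarrow> 'a"
    and L :: "'a alg_closure set" and h s :: nat
  assumes h: "h \<ge> 2" and s: "s \<ge> 2" and finL: "finite L"
    and L_mult: "\<And>x y. x \<in> L \<Longrightarrow> y \<in> L \<Longrightarrow> x * y \<in> L" and L_1: "1 \<in> L"
    and e: "\<And>i. i < h \<Longrightarrow> e i \<in> L"
    and co: "\<And>x. x \<in> L \<Longrightarrow> x = (\<Sum>l<h. to_ac (co x l) * e l)"
    and indep: "\<And>c i. (\<Sum>l<h. to_ac (c l) * e l) = 0 \<Longrightarrow> i < h \<Longrightarrow> c i = 0"
begin

section \<open>Encoding of vectors as polynomials and evaluation functionals\<close>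

definition r :: nat where "r = s * h + h div 2"

lemma r_less: "r < (s + 1) * h"
  using h by (simp add: r_def)

text \<open>Index i = j h + k stands for the monomial e_k X^j. Entry i is the l-th coordinate of its
  value at x, so pairing with c yields the l-th coordinate of f_c(x).\<close>

definition eval_vec :: "'a alg_closure \<Rightarrow> nat \<Rightarrow> 'a vec" where
  "eval_vec x l = vec r (\<lambda>i. co (e (i mod h) * x ^ (i div h)) l)"

text \<open>Extension by zero to all positions, so that the shortened last block can be treated as a
  full block of length h.\<close>

definition code_coeff :: "'a vec \<Rightarrow> nat \<Rightarrow> 'a" where
  "code_coeff c i = (if i < r then c $ i else 0)"

definition code_poly :: "'a vec \<Rightarrow> 'a alg_closure poly" where
  "code_poly c = (\<Sum>j<s + 1. Polynomial.monom (\<Sum>k<h. to_ac (code_coeff c (j * h + k)) * e k) j)"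

lemma coeff_code_poly:
  "poly.coeff (code_poly c) j =
    (if j < s + 1 then \<Sum>k<h. to_ac (code_coeff c (j * h + k)) * e k else 0)"
  by (simp add: code_poly_def coeff_sum)

lemma coeff_code_poly_eq_0:
  assumes "\<And>k. k < h \<Longrightarrow> code_coeff c (j * h + k) = 0"
  shows "poly.coeff (code_poly c) j = 0"
  using assms by (simp add: coeff_code_poly)

text \<open>Every entry of c is a coordinate of some coefficient, and independence of the
  \<open>e\<close> family recovers it from that coefficient.\<close>

lemma code_poly_nonzero:
  assumes "c \<in> carrier_vec r" "c \<noteq> 0\<^sub>v r"
  shows "code_poly c \<noteq> 0"
proof
  assume "code_poly c = 0"
  have "c $ i = 0" if i: "i < r" for i
  proof -
    have "i div h < s + 1" using i r_less h by (simp add: div_less_iff_less_mult)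
    then have "(\<Sum>k<h. to_ac (code_coeff c (i div h * h + k)) * e k) = 0"
      using coeff_code_poly[of c "i div h"] \<open>code_poly c = 0\<close> by simp
    then have "code_coeff c (i div h * h + i mod h) = 0"
      using indep[of "\<lambda>k. code_coeff c (i div h * h + k)" "i mod h"] h by simp
    then show ?thesis using i by (simp add: code_coeff_def)
  qed
  then show False using assms by (metis carrier_vecD eq_vecI index_zero_vec)
qed

text \<open>Each e_k x^j is expanded in the basis and the sums are exchanged. Hence x is a root as
  soon as c is orthogonal to all h evaluation vectors at x.\<close>

lemma poly_code_poly:
  assumes x: "x \<in> L" and c: "c \<in> carrier_vec r"
  shows "poly (code_poly c) x = (\<Sum>l<h. to_ac (eval_vec x l \<bullet> c) * e l)"
proof -
  have xL: "e k * x ^ j \<in> L" if "k < h" for k j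
  proof -
    have "x ^ j \<in> L" by (induction j) (simp_all add: L_1 L_mult x)
    then show ?thesis using that e L_mult by simp
  qed
  define t where "t = (\<lambda>i l. code_coeff c i * co (e (i mod h) * x ^ (i div h)) l)"
  have expand: "to_ac (code_coeff c i) * e (i mod h) * x ^ (i div h) =
      (\<Sum>l<h. to_ac (t i l) * e l)" for i
  proof -
    have "e (i mod h) * x ^ (i div h) = (\<Sum>l<h. to_ac (co (e (i mod h) * x ^ (i div h)) l) * e l)"
      using h by (intro co xL) simp
    then have "to_ac (code_coeff c i) * (e (i mod h) * x ^ (i div h)) =
        to_ac (code_coeff c i) * (\<Sum>l<h. to_ac (co (e (i mod h) * x ^ (i div h)) l) * e l)"
      by (rule arg_cong)
    then show ?thesis
      unfolding t_def by (simp add: sum_distrib_left mult.assoc)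
  qed
  have "poly (code_poly c) x =
      (\<Sum>j<s + 1. \<Sum>k<h. to_ac (code_coeff c (j * h + k)) * e k * x ^ j)"
    by (simp add: code_poly_def poly_sum poly_monom sum_distrib_right)
  \<comment> \<open>Substituting i = j h + k turns the blocks into consecutive intervals, which then
    merge into one range.\<close>
  also have "\<dots> = (\<Sum>j<s + 1. \<Sum>i\<in>{j * h..<j * h + h}.
      to_ac (code_coeff c i) * e (i mod h) * x ^ (i div h))"
  proof (rule sum.cong[OF refl])
    fix j
    show "(\<Sum>k<h. to_ac (code_coeff c (j * h + k)) * e k * x ^ j) =
        (\<Sum>i\<in>{j * h..<j * h + h}. to_ac (code_coeff c i) * e (i mod h) * x ^ (i div h))"
      by (rule sum.reindex_bij_witness[of _ "\<lambda>i. i - j * h" "\<lambda>k. j * h + k"])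
        (use h in \<open>auto simp: less_diff_conv2\<close>)
  qed
  also have "\<dots> = (\<Sum>i<(s + 1) * h. to_ac (code_coeff c i) * e (i mod h) * x ^ (i div h))"
    by (rule sum.nat_group)
  also have "\<dots> = (\<Sum>i<(s + 1) * h. \<Sum>l<h. to_ac (t i l) * e l)"
    by (simp only: expand)
  also have "\<dots> = (\<Sum>l<h. to_ac (\<Sum>i<(s + 1) * h. t i l) * e l)"
    by (subst sum.swap) (simp add: to_ac_sum sum_distrib_right)
  also have "\<dots> = (\<Sum>l<h. to_ac (eval_vec x l \<bullet> c) * e l)"
  proof (rule sum.cong[OF refl])
    fix l
    have "(\<Sum>i<(s + 1) * h. t i l) = (\<Sum>i<r. t i l)"
      using r_less by (intro sum.mono_neutral_right) (auto simp: t_def code_coeff_def)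
    also have "\<dots> = eval_vec x l \<bullet> c"
      using c by (simp add: t_def code_coeff_def eval_vec_def scalar_prod_def lessThan_atLeast0 mult.commute)
    finally show "to_ac (\<Sum>i<(s + 1) * h. t i l) * e l = to_ac (eval_vec x l \<bullet> c) * e l" by simp
  qed
  finally show ?thesis .
qed

section \<open>Degree drops and root counts\<close>

lemma card_roots_le:
  assumes "c \<in> carrier_vec r" "c \<noteq> 0\<^sub>v r" "\<And>j. j > d \<Longrightarrow> poly.coeff (code_poly c) j = 0"
  shows "card {x \<in> L. poly (code_poly c) x = 0} \<le> d"
proof -
  have nz: "code_poly c \<noteq> 0" using code_poly_nonzero assms by blast
  have "card {x \<in> L. poly (code_poly c) x = 0} \<le> card {x. poly (code_poly c) x = 0}"
    by (intro card_mono poly_roots_finite nz) auto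
  also have "\<dots> \<le> Polynomial.degree (code_poly c)"
    by (rule card_poly_roots_bound[OF nz])
  also have "\<dots> \<le> d"
    using assms(3) by (intro degree_le) simp
  finally show ?thesis .
qed

(* Both index sets contain the positions of the coefficient of x^s. The remaining h - h div 2
   positions of each lie in the block of x^(s-1) and together cover it, as 2 * (h div 2) <= h. *)
definition idx1 :: "nat set" where
  "idx1 = {(s - 1) * h..<(s - 1) * h + (h - h div 2)} \<union> {s * h..<r}"

definition idx2 :: "nat set" where
  "idx2 = {(s - 1) * h + h div 2..<s * h} \<union> {s * h..<r}"

lemma pred_mult: "(s - 1) * h + h = s * h"
  using s by (cases s) simp_all

lemma idx_subset: "idx1 \<subseteq> {..<r}" "idx2 \<subseteq> {..<r}"
  using pred_mult unfolding idx1_def idx2_def r_def by auto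

lemma card_idx: "card idx1 \<le> h" "card idx2 \<le> h"
proof -
  have "card idx1 \<le> (h - h div 2) + h div 2"
    unfolding idx1_def by (rule card_Un_le[THEN le_trans]) (simp add: r_def)
  then show "card idx1 \<le> h" by simp
  have "card idx2 \<le> (s * h - ((s - 1) * h + h div 2)) + h div 2"
    unfolding idx2_def by (rule card_Un_le[THEN le_trans]) (simp add: r_def)
  also have "s * h - ((s - 1) * h + h div 2) = h - h div 2"
    using pred_mult by linarith
  finally show "card idx2 \<le> h" by simp
qed

lemma idx_Un: "i < r \<Longrightarrow> (s - 1) * h \<le> i \<Longrightarrow> i \<in> idx1 \<union> idx2"
  unfolding idx1_def idx2_def by auto

text \<open>Each index set alone contains the whole last block, and \<open>code_coeff\<close> is
  zero from position \<open>r\<close> on.\<close>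

lemma coeff_top_eq_0:
  fixes c :: "'a vec"
  assumes "(\<forall>i\<in>idx1. c $ i = 0) \<or> (\<forall>i\<in>idx2. c $ i = 0)" "j \<ge> s"
  shows "poly.coeff (code_poly c) j = 0"
proof (rule coeff_code_poly_eq_0)
  fix k assume "k < h"
  have "s * h \<le> j * h + k" using assms(2) by (simp add: trans_le_add1)
  then show "code_coeff c (j * h + k) = 0"
    using assms(1) by (auto simp: code_coeff_def idx1_def idx2_def)
qed

text \<open>Together the index sets cover every position of c from the block of x^(s-1) on.\<close>

lemma coeff_second_eq_0:
  fixes c :: "'a vec"
  assumes "\<forall>i\<in>idx1. c $ i = 0" "\<forall>i\<in>idx2. c $ i = 0" "j \<ge> s - 1"
  shows "poly.coeff (code_poly c) j = 0"
proof (rule coeff_code_poly_eq_0)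
  fix k assume "k < h"
  have "(s - 1) * h \<le> j * h + k" using assms(3) by (simp add: trans_le_add1)
  then show "code_coeff c (j * h + k) = 0"
    using assms(1,2) idx_Un[of "j * h + k"] by (auto simp: code_coeff_def)
qed

lemma code_zeros_le:
  fixes c :: "'a vec"
  assumes c: "c \<in> carrier_vec r" "c \<noteq> 0\<^sub>v r"
  shows "card {x \<in> L. poly (code_poly c) x = 0} + of_bool (\<forall>i\<in>idx1. c $ i = 0)
    + of_bool (\<forall>i\<in>idx2. c $ i = 0) \<le> s"
proof -
  consider "\<forall>i\<in>idx1. c $ i = 0" "\<forall>i\<in>idx2. c $ i = 0"
    | "(\<forall>i\<in>idx1. c $ i = 0) \<noteq> (\<forall>i\<in>idx2. c $ i = 0)"
    | "\<not> (\<forall>i\<in>idx1. c $ i = 0)" "\<not> (\<forall>i\<in>idx2. c $ i = 0)" by blast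
  then show ?thesis
  proof cases
    case 1
    have "card {x \<in> L. poly (code_poly c) x = 0} \<le> s - 2"
      by (rule card_roots_le[OF c]) (rule coeff_second_eq_0[OF 1], simp)
    moreover have "of_bool (\<forall>i\<in>idx1. c $ i = 0) = (1::nat)" "of_bool (\<forall>i\<in>idx2. c $ i = 0) = (1::nat)"
      using 1 by simp_all
    \<comment> \<open>Here \<open>s \<ge> 2\<close> turns the truncated difference into (s - 2) + 2
      = s.\<close>
    ultimately show ?thesis using s by linarith
  next
    case 2
    have "card {x \<in> L. poly (code_poly c) x = 0} \<le> s - 1"
      by (rule card_roots_le[OF c], rule coeff_top_eq_0) (use 2 in auto)
    moreover have "of_bool (\<forall>i\<in>idx1. c $ i = 0) + of_bool (\<forall>i\<in>idx2. c $ i = 0) = (1::nat)"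
      using 2 by (auto simp del: Ball_def)
    ultimately show ?thesis using s by linarith
  next
    case 3
    have "card {x \<in> L. poly (code_poly c) x = 0} \<le> s"
      by (rule card_roots_le[OF c]) (simp add: coeff_code_poly)
    moreover have "of_bool (\<forall>i\<in>idx1. c $ i = 0) = (0::nat)" "of_bool (\<forall>i\<in>idx2. c $ i = 0) = (0::nat)"
      using 3 by simp_all
    ultimately show ?thesis by linarith
  qed
qed

section \<open>Assembly of the projective system\<close>

lemma max_projective_system_ge_card: "card L + 2 \<le> max_projective_system TYPE('a) r h s"
proof -
  have "\<exists>V. vec_subspace TYPE('a) r V \<and> vec_subspace_dim TYPE('a) r V \<le> h \<and> eval_vec x ` {..<h} \<subseteq> V" for x
    using card_image_le[of "{..<h}" "eval_vec x"] by (intro vec_subspace_containing) (auto simp: eval_vec_def)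
  then obtain W where W: "\<And>x. vec_subspace TYPE('a) r (W x)"
      "\<And>x. vec_subspace_dim TYPE('a) r (W x) \<le> h" "\<And>x. eval_vec x ` {..<h} \<subseteq> W x"
    by metis
  have U_ex: "\<exists>V. vec_subspace TYPE('a) r V \<and> vec_subspace_dim TYPE('a) r V \<le> h \<and> unit_vec r ` I \<subseteq> V"
    if "I \<subseteq> {..<r}" "card I \<le> h" for I
    using that finite_subset[OF that(1)] card_image_le[of I "unit_vec r :: nat \<Rightarrow> 'a vec"]
    by (intro vec_subspace_containing) auto
  obtain U1 where U1: "vec_subspace TYPE('a) r U1" "vec_subspace_dim TYPE('a) r U1 \<le> h"
      "unit_vec r ` idx1 \<subseteq> U1"
    using U_ex[OF idx_subset(1) card_idx(1)] by blast
  obtain U2 where U2: "vec_subspace TYPE('a) r U2" "vec_subspace_dim TYPE('a) r U2 \<le> h"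
      "unit_vec r ` idx2 \<subseteq> U2"
    using U_ex[OF idx_subset(2) card_idx(2)] by blast
  \<comment> \<open>The multiset image counts \<open>W x\<close> once for every x, even if different
    x give the same subspace.\<close>
  define S where "S = image_mset W (mset_set L) + {#U1, U2#}"
  have "size {#V \<in># S. V \<subseteq> H#} \<le> s" if H: "vec_hyperplane TYPE('a) r H" for H
  proof -
    \<comment> \<open>A nonzero vector orthogonal to \<open>H\<close> turns containment in
      \<open>H\<close> into vanishing conditions on c.\<close>
    obtain c where c: "c \<in> carrier_vec r" "c \<noteq> 0\<^sub>v r" and cH: "\<And>v. v \<in> H \<Longrightarrow> v \<bullet> c = 0"
      using vec_subspace_in_kernel[of H r] H by (auto simp: vec_hyperplane_def)
    have root: "poly (code_poly c) x = 0" if "x \<in> L" "W x \<subseteq> H" for x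
    proof -
      have "eval_vec x l \<bullet> c = 0" if "l < h" for l
        using W(3)[of x] \<open>W x \<subseteq> H\<close> that by (intro cH) auto
      then show ?thesis using poly_code_poly[OF \<open>x \<in> L\<close> c(1)] by simp
    qed
    have coord: "\<forall>i\<in>I. c $ i = 0" if "unit_vec r ` I \<subseteq> H" "I \<subseteq> {..<r}" for I
    proof
      fix i assume i: "i \<in> I"
      have "unit_vec r i \<bullet> c = 0"
        using that(1) i by (intro cH) auto
      then show "c $ i = 0" using scalar_prod_left_unit[OF c(1)] i that(2) by auto
    qed
    have "size {#V \<in># S. V \<subseteq> H#} = card {x \<in> L. W x \<subseteq> H}
        + of_bool (U1 \<subseteq> H) + of_bool (U2 \<subseteq> H)"
      using finL by (simp add: S_def filter_mset_image_mset filter_mset_mset_set comp_def)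
    also have "\<dots> \<le> card {x \<in> L. poly (code_poly c) x = 0} + of_bool (\<forall>i\<in>idx1. c $ i = 0)
        + of_bool (\<forall>i\<in>idx2. c $ i = 0)"
    proof (intro add_mono card_mono)
      show "of_bool (U1 \<subseteq> H) \<le> (of_bool (\<forall>i\<in>idx1. c $ i = 0) :: nat)"
        using coord[OF _ idx_subset(1)] U1(3) by (auto simp: of_bool_def)
      show "of_bool (U2 \<subseteq> H) \<le> (of_bool (\<forall>i\<in>idx2. c $ i = 0) :: nat)"
        using coord[OF _ idx_subset(2)] U2(3) by (auto simp: of_bool_def)
    qed (use root finL in auto)
    also have "\<dots> \<le> s" by (rule code_zeros_le[OF c])
    finally show ?thesis .
  qed
  moreover have "vec_subspace TYPE('a) r V \<and> vec_subspace_dim TYPE('a) r V \<le> h" if "V \<in># S" for V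
    using that W(1,2) U1(1,2) U2(1,2) finL by (auto simp: S_def)
  \<comment> \<open>This puts every member into some hyperplane, which keeps the set under
    \<open>Max\<close> finite.\<close>
  moreover have "h < r"
  proof -
    have "2 * h \<le> s * h" using s by (rule mult_le_mono1)
    then show ?thesis using h unfolding r_def by linarith
  qed
  ultimately have "size S \<le> max_projective_system TYPE('a) r h s"
    by (intro max_projective_system_ge_size)
  then show ?thesis by (simp add: S_def)
qed

end

theorem theorem4:
  fixes q h s :: nat
  assumes "primepow q"
    and "card (UNIV :: 'a::{finite,field} set) = q"
    and "h \<ge> 2" and "s \<ge> 2"
  shows "max_projective_system TYPE('a) (h * s + h div 2) h s \<ge> q ^ h + 2"
proof -
  have pp: "primepow (card (UNIV :: 'a set))" and h: "h > 0" using assms by simp_all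
  obtain e :: "nat \<Rightarrow> 'a alg_closure" and co :: "'a alg_closure \<Rightarrow> nat \<Rightarrow> 'a" where
    e: "\<forall>i<h. e i \<in> extension_field h" and
    co: "\<forall>x\<in>extension_field h. x = (\<Sum>i<h. to_ac (co x i) * e i)" and
    indep: "\<forall>c. (\<Sum>i<h. to_ac (c i) * e i) = 0 \<longrightarrow> (\<forall>i<h. c i = 0)"
    by (rule extension_field_basis[OF pp h]) (rule that)
  have card: "card (extension_field h :: 'a alg_closure set) = q ^ h"
    using card_extension_field[OF pp h] assms(2) by simp
  have "q ^ h > 0" using primepow_gt_0_nat[OF assms(1)] by simp
  \<comment> \<open>Closure under products holds because raising to the power q^h is multiplicative,
    so its fixed points are closed under multiplication.\<close>
  interpret extension_code e co "extension_field h" h s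
  proof
    show "finite (extension_field h :: 'a alg_closure set)"
      using card \<open>q ^ h > 0\<close> by (metis card.infinite less_irrefl)
    show "x * y \<in> extension_field h" if "x \<in> extension_field h" "y \<in> extension_field h"
      for x y :: "'a alg_closure"
      using that by (simp add: extension_field_def power_mult_distrib)
    show "(1 :: 'a alg_closure) \<in> extension_field h"
      by (simp add: extension_field_def)
    show "x = (\<Sum>l<h. to_ac (co x l) * e l)" if "x \<in> extension_field h" for x
      using co that by (rule bspec)
    show "c i = 0" if "(\<Sum>l<h. to_ac (c l) * e l) = 0" "i < h" for c :: "nat \<Rightarrow> 'a" and i
      using indep that by blast
    show "e i \<in> extension_field h" if "i < h" for i
      using e that by blast
  qed (fact assms(3) assms(4))+
  show ?thesis
    using max_projective_system_ge_card card by (simp add: r_def mult.commute)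
qed

end
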